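(* Let $G$ be a countable infinite discrete amenable group acting continuously on a compact metric space $(X,d)$, and let $\{F_n\}_{n=1}^{\infty}$ be a Følner sequence in $G$ with $|F_n|$ increasing and satisfying $\lim_{n\to\infty}\frac{|F_n|}{\log n}=\infty$. Let $\mu\in M(X)$, $H\subset X$, and let $\Phi:X\to\mathbb{R}$ be a positive continuous function. For each $s\in(0,\infty)$: (1) if $\overline{P}_{\mu}^{\widetilde{BK}}(\{F_n\}_{n=1}^{\infty},\Phi,x)\le s$ for all $x\in H$, then $\dim_H^{\widetilde{BSP}}(\{F_n\}_{n=1}^{\infty},\Phi)\le s$; (2) if $\overline{P}_{\mu}^{\widetilde{BK}}(\{F_n\}_{n=1}^{\infty},\Phi,x)\ge s$ for all $x\in H$, and $\mu(H)>0$ (with $H$ being $\mu$-measurable), then $\dim_H^{\widetilde{BSP}}(\{F_n\}_{n=1}^{\infty},\Phi)\ge s$.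
   Context: A Følner sequence in $G$ is a sequence of non-empty finite subsets $F_n\subset G$ with $\lim_{n\to\infty}|F_n\triangle gF_n|/|F_n|=0$ for every $g\in G$. $M(X)$ is the set of Borel probability measures on $X$. For finite $F\subset G$: $d_F(x,y)=\max_{g\in F}d(gx,gy)$, $B_F(x,\epsilon)=\{y:d_F(x,y)<\epsilon\}$, $\overline B_F(x,\epsilon)=\{y:d_F(x,y)\le\epsilon\}$, and $\Phi_F(x)=\sum_{g\in F}\Phi(gx)$. For $\mu\in M(X)$ and $x\in X$, $$\overline{P}_{\mu}^{\widetilde{BK}}(\{F_n\},\Phi,x)=\lim_{\epsilon\to0}\limsup_{n\to\infty}\frac{-\log\mu(B_{F_n}(x,\epsilon))}{\Phi_{F_n}(x)}\in[0,\infty].$$ BS packing dimension of a set (values in $[0,\infty]$; $s>0$, $\sup\emptyset=0$, $\inf\emptyset=\infty$). For $H\subset X$, $\epsilon>0$, $N\in\mathbb{N}$ let $$L^{s}_{N,\epsilon}(H,\{F_n\},\Phi)=\sup\sum_{i\in I}\exp\Big(-s\sup_{y\in\overline B_{F_{n_i}}(x_i,\epsilon)}\Phi_{F_{n_i}}(y)\Big),$$ the supremum over all finite or countable pairwise disjoint families $\{\overline B_{F_{n_i}}(x_i,\epsilon)\}_{i\in I}$ with $n_i\ge N$, $x_i\in H$. Let $L^s_\epsilon(H,\{F_n\},\Phi)=\lim_{N\to\infty}L^s_{N,\epsilon}(H,\{F_n\},\Phi)$, $\mathscr L^s_\epsilon(H,\{F_n\},\Phi)=\inf\{\sum_{i=1}^\infty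 L^s_\epsilon(H_i,\{F_n\},\Phi):H\subset\bigcup_{i=1}^\infty H_i\}$, $\mathscr L_\epsilon(H,\{F_n\},\Phi)=\sup\{s:\mathscr L^s_\epsilon=\infty\}=\inf\{s:\mathscr L^s_\epsilon=0\}$, and $\dim_H^{\widetilde{BSP}}(\{F_n\},\Phi)=\lim_{\epsilon\to0}\mathscr L_\epsilon(H,\{F_n\},\Phi)$. *)

theory Defs
  imports "HOL-Probability.Probability" "HOL-Algebra.Group_Action"
begin

(* Sequences {F_n} are indexed by n >= 1 as in the mathematics: the value F 0 is unconstrained
   and enters no limit below. *)
definition folner_sequence :: "('g, 'b) monoid_scheme \<Rightarrow> (nat \<Rightarrow> 'g set) \<Rightarrow> bool" where
  "folner_sequence G F \<longleftrightarrow>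
     (\<forall>n\<ge>1. finite (F n) \<and> F n \<noteq> {} \<and> F n \<subseteq> carrier G) \<and>
     (\<forall>g\<in>carrier G.
        (\<lambda>n. real (card (sym_diff (F n) (g <#\<^bsub>G\<^esub> F n))) / real (card (F n))) \<longlonglongrightarrow> 0)"

(* Amenability of a countable discrete group, in Folner's form. *)
definition amenable :: "('g, 'b) monoid_scheme \<Rightarrow> bool" where
  "amenable G \<longleftrightarrow> (\<exists>F. folner_sequence G F)"

(* G is discrete, so an action is continuous iff every group element acts continuously. *)
definition continuous_action ::
    "('g, 'b) monoid_scheme \<Rightarrow> ('g \<Rightarrow> 'x::topological_space \<Rightarrow> 'x) \<Rightarrow> bool" where
  "continuous_action G act \<longleftrightarrow>
     group_action G UNIV act \<and> (\<forall>g\<in>carrier G. continuous_on UNIV (act g))"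

definition borel_prob_measures :: "'x::topological_space measure set" where
  "borel_prob_measures = {\<mu>. sets \<mu> = sets borel \<and> prob_space \<mu>}"

(* Meaningful for finite non-empty K only. *)
definition bowen_dist :: "('g \<Rightarrow> 'x::metric_space \<Rightarrow> 'x) \<Rightarrow> 'g set \<Rightarrow> 'x \<Rightarrow> 'x \<Rightarrow> real" where
  "bowen_dist act K x y = (MAX g\<in>K. dist (act g x) (act g y))"

definition bowen_ball :: "('g \<Rightarrow> 'x::metric_space \<Rightarrow> 'x) \<Rightarrow> 'g set \<Rightarrow> 'x \<Rightarrow> real \<Rightarrow> 'x set" where
  "bowen_ball act K x \<epsilon> = {y. bowen_dist act K x y < \<epsilon>}"

definition bowen_cball :: "('g \<Rightarrow> 'x::metric_space \<Rightarrow> 'x) \<Rightarrow> 'g set \<Rightarrow> 'x \<Rightarrow> real \<Rightarrow> 'x set" where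
  "bowen_cball act K x \<epsilon> = {y. bowen_dist act K x y \<le> \<epsilon>}"

definition orbit_sum :: "('g \<Rightarrow> 'x \<Rightarrow> 'x) \<Rightarrow> ('x \<Rightarrow> real) \<Rightarrow> 'g set \<Rightarrow> 'x \<Rightarrow> real" where
  "orbit_sum act \<Phi> K x = (\<Sum>g\<in>K. \<Phi> (act g x))"

(* -log p in [0,\<infinity>] for a probability p, with -log 0 = \<infinity> (the library has ln 0 = 0). *)
definition neg_log :: "real \<Rightarrow> ennreal" where
  "neg_log p = (if p = 0 then \<infinity> else ennreal (- ln p))"

(* All limits as \<epsilon> \<rightarrow> 0+ or N \<rightarrow> \<infinity> taken with Lim or lim are limits of monotone
   [0,\<infinity>]-valued functions, hence exist, when \<Phi> is positive and bounded and folner_sequence G F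
   holds. *)
definition upper_BK_local_entropy ::
    "('g \<Rightarrow> 'x::metric_space \<Rightarrow> 'x) \<Rightarrow> 'x measure \<Rightarrow> (nat \<Rightarrow> 'g set) \<Rightarrow> ('x \<Rightarrow> real) \<Rightarrow> 'x \<Rightarrow> ennreal" where
  "upper_BK_local_entropy act \<mu> F \<Phi> x =
     Lim (at_right (0::real)) (\<lambda>\<epsilon>.
       limsup (\<lambda>n. neg_log (measure \<mu> (bowen_ball act (F n) x \<epsilon>))
                   / ennreal (orbit_sum act \<Phi> (F n) x)))"

(* Finite or countable families are indexed by arbitrary subsets I of nat; the centre and the
   time of the i-th ball are c i and m i.  All suprema, infima and sums outside the exponential
   are taken in [0,\<infinity>]; in particular Sup {} = 0 and Inf {} = \<infinity>. *)
definition BSP_premeasure_at ::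
    "('g \<Rightarrow> 'x::metric_space \<Rightarrow> 'x) \<Rightarrow> (nat \<Rightarrow> 'g set) \<Rightarrow> ('x \<Rightarrow> real) \<Rightarrow> real \<Rightarrow> real \<Rightarrow> nat
      \<Rightarrow> 'x set \<Rightarrow> ennreal" where
  "BSP_premeasure_at act F \<Phi> s \<epsilon> N H =
     Sup {(\<Sum>\<^sub>\<infinity>i\<in>I. ennreal (exp (- s * (SUP y\<in>bowen_cball act (F (m i)) (c i) \<epsilon>.
                                         orbit_sum act \<Phi> (F (m i)) y)))) |
            (I :: nat set) (c :: nat \<Rightarrow> 'x) (m :: nat \<Rightarrow> nat).
            (\<forall>i\<in>I. N \<le> m i \<and> c i \<in> H) \<and>
            disjoint_family_on (\<lambda>i. bowen_cball act (F (m i)) (c i) \<epsilon>) I}"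

definition BSP_premeasure ::
    "('g \<Rightarrow> 'x::metric_space \<Rightarrow> 'x) \<Rightarrow> (nat \<Rightarrow> 'g set) \<Rightarrow> ('x \<Rightarrow> real) \<Rightarrow> real \<Rightarrow> real
      \<Rightarrow> 'x set \<Rightarrow> ennreal" where
  "BSP_premeasure act F \<Phi> s \<epsilon> H = lim (\<lambda>N. BSP_premeasure_at act F \<Phi> s \<epsilon> N H)"

definition BSP_measure ::
    "('g \<Rightarrow> 'x::metric_space \<Rightarrow> 'x) \<Rightarrow> (nat \<Rightarrow> 'g set) \<Rightarrow> ('x \<Rightarrow> real) \<Rightarrow> real \<Rightarrow> real
      \<Rightarrow> 'x set \<Rightarrow> ennreal" where
  "BSP_measure act F \<Phi> s \<epsilon> H =
     Inf {(\<Sum>i. BSP_premeasure act F \<Phi> s \<epsilon> (A i)) | A :: nat \<Rightarrow> 'x set. H \<subseteq> (\<Union>i. A i)}"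

(* The critical exponent.  It also equals Inf {ennreal s | s. 0 < s \<and> BSP_measure ... = 0} when
   card (F n) tends to infinity and \<Phi> is positive and continuous on a compact space. *)
definition BSP_dim_at ::
    "('g \<Rightarrow> 'x::metric_space \<Rightarrow> 'x) \<Rightarrow> (nat \<Rightarrow> 'g set) \<Rightarrow> ('x \<Rightarrow> real) \<Rightarrow> real \<Rightarrow> 'x set \<Rightarrow> ennreal" where
  "BSP_dim_at act F \<Phi> \<epsilon> H =
     Sup {ennreal s | s :: real. 0 < s \<and> BSP_measure act F \<Phi> s \<epsilon> H = \<infinity>}"

definition BSP_dim ::
    "('g \<Rightarrow> 'x::metric_space \<Rightarrow> 'x) \<Rightarrow> (nat \<Rightarrow> 'g set) \<Rightarrow> ('x \<Rightarrow> real) \<Rightarrow> 'x set \<Rightarrow> ennreal" where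
  "BSP_dim act F \<Phi> H = Lim (at_right (0::real)) (\<lambda>\<epsilon>. BSP_dim_at act F \<Phi> \<epsilon> H)"

end

theory Submission
  imports Defs
begin

text \<open>
  The theorem is a Billingsley-type comparison. Write \<open>S n x\<close> for the orbit sum of \<open>\<Phi>\<close> over
  \<open>F n\<close>. As the scale shrinks, the local entropies and the critical exponents only grow, so both
  limits are suprema over \<open>\<epsilon> > 0\<close> and the two bounds can be proved one scale at a time.

  Upper bound. If the local entropy is at most \<open>s < t\<close> on \<open>H\<close>, then \<open>H\<close> is a countable union of
  sets \<open>E k\<close> on which every Bowen ball of time \<open>n \<ge> k\<close> has measure at least \<open>exp (- t * S n x)\<close>.
  Disjoint balls have total measure at most 1. For an exponent \<open>r > t\<close> each such ball of time \<open>n\<close>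
  weighs at most \<open>exp (- c * card (F n))\<close> times its measure for some \<open>c > 0\<close>, and this factor
  tends to 0, so the packing pre-measure of every \<open>E k\<close> vanishes
  (\<open>premeasure_eq_0\<close>).

  Lower bound. Let \<open>r < t < s\<close>. If the local entropy is at least \<open>s\<close> on \<open>H\<close>, then every point
  of \<open>H\<close> has, at some scale \<open>\<epsilon>\<close>, infinitely many times \<open>n\<close> at which its ball has measure less
  than \<open>exp (- t * S n x)\<close>. Were the packing measure with exponent \<open>r\<close> finite at a scale
  \<open>\<delta> < \<epsilon> / 2\<close>, these points would form a null set: for each \<open>n\<close>, a maximal disjoint family of
  \<open>\<delta>\<close>-balls centred at the points that are bad at time \<open>n\<close> gives a cover of those points by
  \<open>\<epsilon>\<close>-balls. Its total measure is at most \<open>exp (- c * card (F n))\<close> times a packing sum, for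
  some \<open>c > 0\<close>, and the packing sums are bounded for large \<open>n\<close>. The growth of \<open>card (F n)\<close> relative to \<open>ln n\<close> makes this
  summable, and the Borel-Cantelli lemma applies (\<open>null_if_premeasure_finite\<close>). Working with a
  single time \<open>n\<close> at once replaces a Vitali-type covering argument.

  The supremum of orbit sums over a ball, which enters the packing weights, costs only a factor
  \<open>1 + \<kappa>\<close> with \<open>\<kappa>\<close> tending to 0 with the radius, because \<open>\<Phi>\<close> is uniformly continuous and bounded
  away from 0 (\<open>small_distortion\<close>).
\<close>

section \<open>Analytic preliminaries\<close>

lemma Lim_at_right_0_antimono:
  fixes f :: "real \<Rightarrow> ennreal"
  assumes anti: "\<And>\<delta> \<epsilon>. 0 < \<delta> \<Longrightarrow> \<delta> \<le> \<epsilon> \<Longrightarrow> f \<epsilon> \<le> f \<delta>"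
  shows "Lim (at_right 0) f = (SUP \<epsilon>\<in>{0<..}. f \<epsilon>)"
proof (rule tendsto_Lim[OF trivial_limit_at_right_real], rule order_tendstoI)
  fix a assume "a < (SUP \<epsilon>\<in>{0<..}. f \<epsilon>)"
  then obtain \<epsilon> where \<epsilon>: "0 < \<epsilon>" "a < f \<epsilon>"
    by (auto simp: less_SUP_iff)
  show "\<forall>\<^sub>F x in at_right 0. a < f x"
    unfolding eventually_at_right_field
    using \<epsilon> anti by (meson less_imp_le less_le_trans)
next
  fix a assume a: "(SUP \<epsilon>\<in>{0<..}. f \<epsilon>) < a"
  have "f x < a" if "0 < x" for x
    using that a by (metis SUP_upper greaterThan_iff le_less_trans)
  then show "\<forall>\<^sub>F x in at_right 0. f x < a"
    unfolding eventually_at_right_field by (meson zero_less_one)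
qed

text \<open>Translates bounds on local rates into bounds on measures. The case \<open>p = 0\<close> is consistent because
  \<open>neg_log 0 = \<infinity>\<close> and exponentials are positive.\<close>

lemma neg_log_divide_le_iff:
  assumes "0 \<le> p" "p \<le> 1" "0 < S" "0 \<le> t"
  shows "neg_log p / ennreal S \<le> ennreal t \<longleftrightarrow> exp (- t * S) \<le> p"
proof (cases "p = 0")
  case True
  then show ?thesis
    using assms by (simp add: neg_log_def ennreal_top_divide top_unique)
next
  case False
  with assms have p: "0 < p" by simp
  then have "neg_log p / ennreal S = ennreal (- ln p / S)"
    using assms by (simp add: neg_log_def divide_ennreal)
  also have "\<dots> \<le> ennreal t \<longleftrightarrow> - ln p / S \<le> t"
    using assms by (simp add: ennreal_le_iff)
  also have "\<dots> \<longleftrightarrow> - t * S \<le> ln p"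
    using assms by (auto simp: field_simps)
  also have "\<dots> \<longleftrightarrow> exp (- t * S) \<le> p"
    using p by (simp add: ln_ge_iff)
  finally show ?thesis .
qed

lemma neg_log_antimono:
  assumes "0 \<le> p" "p \<le> q"
  shows "neg_log q \<le> neg_log p"
  using assms by (auto simp: neg_log_def intro!: ennreal_leI)

text \<open>Eventually \<open>f n \<ge> (2 / c) * ln n\<close>, so the terms are dominated by \<open>1 / n\<^sup>2\<close>.\<close>

lemma summable_exp_minus_mult:
  fixes f :: "nat \<Rightarrow> real"
  assumes f: "filterlim (\<lambda>n. f n / ln (real n)) at_top sequentially" and "0 < c"
  shows "summable (\<lambda>n. exp (- c * f n))"
proof (rule summable_comparison_test_ev)
  have "\<forall>\<^sub>F n in sequentially. 2 / c \<le> f n / ln (real n)"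
    using f by (simp add: filterlim_at_top)
  then show "\<forall>\<^sub>F n in sequentially. norm (exp (- c * f n)) \<le> 1 / real n ^ 2"
    using eventually_ge_at_top[of 2]
  proof eventually_elim
    case (elim n)
    then have "2 * ln (real n) \<le> c * f n"
      using \<open>0 < c\<close> by (simp add: field_simps)
    then have "exp (- c * f n) \<le> exp (- (2 * ln (real n)))"
      by simp
    also have "\<dots> = 1 / real n ^ 2"
      using elim by (simp add: exp_minus exp_double field_simps)
    finally show ?case by simp
  qed
  show "summable (\<lambda>n. 1 / real n ^ 2)"
    using inverse_power_summable[of 2, where 'a=real] by (simp add: field_simps)
qed

section \<open>Bowen balls and orbit sums\<close>

text \<open>The conditions are restricted to \<open>n \<ge> 1\<close> because \<open>F 0\<close> is arbitrary.\<close>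

locale bowen_system =
  fixes act :: "'g \<Rightarrow> 'x::metric_space \<Rightarrow> 'x"
    and F :: "nat \<Rightarrow> 'g set"
    and \<Phi> :: "'x \<Rightarrow> real"
  assumes compact_space: "compact (UNIV :: 'x set)"
    and continuous_act: "\<And>n g. 1 \<le> n \<Longrightarrow> g \<in> F n \<Longrightarrow> continuous_on UNIV (act g)"
    and finite_F: "\<And>n. 1 \<le> n \<Longrightarrow> finite (F n)"
    and nonempty_F: "\<And>n. 1 \<le> n \<Longrightarrow> F n \<noteq> {}"
    and continuous_\<Phi>: "continuous_on UNIV \<Phi>"
    and \<Phi>_pos: "\<And>x. 0 < \<Phi> x"
begin

abbreviation B where "B n x \<epsilon> \<equiv> bowen_ball act (F n) x \<epsilon>"
abbreviation C where "C n x \<epsilon> \<equiv> bowen_cball act (F n) x \<epsilon>"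
abbreviation S where "S n x \<equiv> orbit_sum act \<Phi> (F n) x"
abbreviation supS where "supS n x \<epsilon> \<equiv> (SUP y\<in>C n x \<epsilon>. S n y)"

lemma mem_ball_iff:
  "1 \<le> n \<Longrightarrow> y \<in> B n x \<epsilon> \<longleftrightarrow> (\<forall>g\<in>F n. dist (act g x) (act g y) < \<epsilon>)"
  unfolding bowen_ball_def bowen_dist_def
  by (simp add: Max_less_iff finite_F nonempty_F)

lemma mem_cball_iff:
  "1 \<le> n \<Longrightarrow> y \<in> C n x \<epsilon> \<longleftrightarrow> (\<forall>g\<in>F n. dist (act g x) (act g y) \<le> \<epsilon>)"
  unfolding bowen_cball_def bowen_dist_def
  by (simp add: Max_le_iff finite_F nonempty_F)

lemma centre_in_ball: "1 \<le> n \<Longrightarrow> 0 < \<epsilon> \<Longrightarrow> x \<in> B n x \<epsilon>"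
  by (simp add: mem_ball_iff)

lemma centre_in_cball: "1 \<le> n \<Longrightarrow> 0 \<le> \<epsilon> \<Longrightarrow> x \<in> C n x \<epsilon>"
  by (simp add: mem_cball_iff)

lemma ball_subset_cball: "B n x \<epsilon> \<subseteq> C n x \<epsilon>"
  by (auto simp: bowen_ball_def bowen_cball_def)

lemma cball_mono: "\<delta> \<le> \<epsilon> \<Longrightarrow> C n x \<delta> \<subseteq> C n x \<epsilon>"
  by (auto simp: bowen_cball_def)

lemma ball_mono: "\<delta> \<le> \<epsilon> \<Longrightarrow> B n x \<delta> \<subseteq> B n x \<epsilon>"
  by (auto simp: bowen_ball_def)

lemma cballs_meet_imp_mem_ball:
  assumes n: "1 \<le> n" and meet: "C n x \<delta> \<inter> C n y \<delta> \<noteq> {}" and "2 * \<delta> < \<epsilon>"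
  shows "y \<in> B n x \<epsilon>"
proof -
  obtain z where z: "z \<in> C n x \<delta>" "z \<in> C n y \<delta>"
    using meet by blast
  have "dist (act g x) (act g y) < \<epsilon>" if "g \<in> F n" for g
    using that z n \<open>2 * \<delta> < \<epsilon>\<close>
      dist_triangle2[of "act g x" "act g y" "act g z"]
    by (fastforce simp: mem_cball_iff)
  then show ?thesis
    using n by (simp add: mem_ball_iff)
qed

lemma open_ball: "1 \<le> n \<Longrightarrow> open (B n x \<epsilon>)"
proof -
  assume n: "1 \<le> n"
  have "B n x \<epsilon> = (\<Inter>g\<in>F n. act g -` ball (act g x) \<epsilon>)"
    using n by (auto simp: mem_ball_iff)
  moreover have "open (\<Inter>g\<in>F n. act g -` ball (act g x) \<epsilon>)"
    using n finite_F continuous_act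
    by (intro open_INT ballI open_vimage) auto
  ultimately show ?thesis by simp
qed

lemma \<Phi>_bounds:
  obtains a b where "0 < a" "\<And>x. a \<le> \<Phi> x" "\<And>x. \<Phi> x \<le> b"
  using continuous_attains_inf[OF compact_space _ continuous_\<Phi>]
    continuous_attains_sup[OF compact_space _ continuous_\<Phi>] \<Phi>_pos
  by (metis UNIV_I UNIV_not_empty)

lemma orbit_sum_ge:
  assumes "\<And>x. a \<le> \<Phi> x"
  shows "a * real (card (F n)) \<le> S n x"
  using sum_mono[of "F n" "\<lambda>_. a" "\<lambda>g. \<Phi> (act g x)"] assms
  by (simp add: orbit_sum_def mult.commute)

lemma orbit_sum_pos: "1 \<le> n \<Longrightarrow> 0 < S n x"
  unfolding orbit_sum_def by (intro sum_pos finite_F nonempty_F \<Phi>_pos)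

lemma bdd_above_orbit_sum: "bdd_above (S n ` Z)"
proof -
  obtain b where b: "\<And>x. \<Phi> x \<le> b"
    using \<Phi>_bounds by metis
  have "S n y \<le> (\<Sum>g\<in>F n. b)" for y
    unfolding orbit_sum_def by (rule sum_mono) (rule b)
  then show ?thesis by (rule bdd_above.I2)
qed

lemma orbit_sum_le_sup: "1 \<le> n \<Longrightarrow> 0 \<le> \<epsilon> \<Longrightarrow> S n x \<le> supS n x \<epsilon>"
  by (intro cSUP_upper bdd_above_orbit_sum centre_in_cball)

lemma sup_orbit_sum_mono:
  assumes "1 \<le> n" "0 \<le> \<delta>" "\<delta> \<le> \<epsilon>"
  shows "supS n x \<delta> \<le> supS n x \<epsilon>"
proof (rule cSUP_subset_mono)
  show "C n x \<delta> \<noteq> {}"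
    using centre_in_cball assms by blast
  show "C n x \<delta> \<subseteq> C n x \<epsilon>"
    using assms(3) by (rule cball_mono)
qed (simp_all add: bdd_above_orbit_sum)

text \<open>If \<open>y\<close> is \<open>\<delta>\<close>-close to \<open>x\<close> along \<open>F n\<close>, uniform continuity changes each summand by at most
  \<open>\<kappa> * a\<close>, where \<open>a > 0\<close> is a lower bound for \<open>\<Phi>\<close>. This is at most \<open>\<kappa>\<close> times the summand itself,
  so the relative error does not depend on \<open>n\<close>.\<close>

lemma small_distortion:
  assumes "0 < \<kappa>"
  obtains \<delta>\<^sub>0 where "0 < \<delta>\<^sub>0"
    "\<And>\<delta> n x. 0 \<le> \<delta> \<Longrightarrow> \<delta> < \<delta>\<^sub>0 \<Longrightarrow> 1 \<le> n \<Longrightarrow> supS n x \<delta> \<le> (1 + \<kappa>) * S n x"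
proof -
  obtain a b where a: "0 < a" "\<And>x. a \<le> \<Phi> x"
    using \<Phi>_bounds by metis
  have "uniformly_continuous_on UNIV \<Phi>"
    by (rule compact_uniformly_continuous[OF continuous_\<Phi> compact_space])
  then obtain \<delta>\<^sub>0 where \<delta>\<^sub>0: "0 < \<delta>\<^sub>0" "\<And>x y. dist y x < \<delta>\<^sub>0 \<Longrightarrow> dist (\<Phi> y) (\<Phi> x) < \<kappa> * a"
    unfolding uniformly_continuous_on_def using a \<open>0 < \<kappa>\<close>
    by (metis UNIV_I mult_pos_pos)
  have "supS n x \<delta> \<le> (1 + \<kappa>) * S n x" if "0 \<le> \<delta>" "\<delta> < \<delta>\<^sub>0" and n: "1 \<le> n" for \<delta> n x
  proof (rule cSUP_least)
    show "C n x \<delta> \<noteq> {}"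
      using centre_in_cball that by blast
  next
    fix y assume y: "y \<in> C n x \<delta>"
    have "\<Phi> (act g y) \<le> (1 + \<kappa>) * \<Phi> (act g x)" if "g \<in> F n" for g
    proof -
      have "dist (act g y) (act g x) < \<delta>\<^sub>0"
        using y that \<open>\<delta> < \<delta>\<^sub>0\<close> unfolding mem_cball_iff[OF n]
        by (metis dist_commute le_less_trans)
      then have "\<Phi> (act g y) \<le> \<Phi> (act g x) + \<kappa> * a"
        using \<delta>\<^sub>0(2)[of "act g y" "act g x"] by (simp add: dist_real_def abs_less_iff)
      also have "\<dots> \<le> \<Phi> (act g x) + \<kappa> * \<Phi> (act g x)"
        using a \<open>0 < \<kappa>\<close> by simp
      finally show ?thesis by (simp add: algebra_simps)
    qed
    then show "S n y \<le> (1 + \<kappa>) * S n x"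
      unfolding orbit_sum_def sum_distrib_left by (rule sum_mono)
  qed
  with \<delta>\<^sub>0(1) show thesis by (rule that)
qed

text \<open>A maximal disjoint family works: the ball of any further point meets one of its members, and
  \<open>2 * \<delta> < \<epsilon>\<close>. Compactness bounds the size of disjoint families, which makes the
  maximum exist and be finite.\<close>

lemma finite_disjoint_cballs_covering:
  assumes n: "1 \<le> n" and "0 < \<delta>" and "2 * \<delta> < \<epsilon>"
  obtains T where "finite T" "T \<subseteq> E" "disjoint_family_on (\<lambda>x. C n x \<delta>) T"
    "E \<subseteq> (\<Union>x\<in>T. B n x \<epsilon>)"
proof -
  obtain D where D: "finite D" "UNIV \<subseteq> (\<Union>x\<in>D. B n x \<delta>)"
    using compactE_image[OF compact_space, of UNIV "\<lambda>x. B n x \<delta>"] open_ball[OF n]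
      centre_in_ball[OF n \<open>0 < \<delta>\<close>] by (metis UNIV_I UN_I subsetI)
  \<comment> \<open>Each ball contains a point of the finite set \<open>D\<close>, so disjoint balls are at most \<open>card D\<close> many.\<close>
  have "\<exists>p. p \<in> D \<and> p \<in> C n x \<delta>" for x
  proof -
    obtain p where "p \<in> D" "x \<in> B n p \<delta>"
      using D(2) by blast
    then show ?thesis
      using n by (auto simp: mem_ball_iff mem_cball_iff dist_commute intro!: less_imp_le)
  qed
  then obtain p where p: "\<And>x. p x \<in> D" "\<And>x. p x \<in> C n x \<delta>"
    by metis
  define P where "P T \<longleftrightarrow> T \<subseteq> E \<and> disjoint_family_on (\<lambda>x. C n x \<delta>) T" for T
  have P_bound: "finite T \<and> card T \<le> card D" if "P T" for T
  proof -
    have "inj_on p T"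
      using that p(2) unfolding P_def disjoint_family_on_def inj_on_def
      by (metis IntI empty_iff)
    then show ?thesis
      using D(1) p(1) by (meson card_inj_on_le image_subsetI inj_on_finite)
  qed
  have "P {}" by (simp add: P_def disjoint_family_on_def)
  then obtain T where T: "P T" "\<And>T'. P T' \<Longrightarrow> card T' \<le> card T"
    using ex_has_greatest_nat[of P "{}" card "Suc (card D)"] P_bound
    by (metis less_Suc_eq_le)
  have "E \<subseteq> (\<Union>x\<in>T. B n x \<epsilon>)"
  proof
    fix y assume "y \<in> E"
    show "y \<in> (\<Union>x\<in>T. B n x \<epsilon>)"
    proof (cases "y \<in> T")
      case True
      then show ?thesis
        using centre_in_ball[OF n, of \<epsilon> y] assms by auto
    next
      case False
      have "\<not> P (insert y T)"
        using T(2)[of "insert y T"] P_bound[OF T(1)] False by auto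
      then obtain x where "x \<in> T" "C n x \<delta> \<inter> C n y \<delta> \<noteq> {}"
        using T(1) \<open>y \<in> E\<close> False unfolding P_def disjoint_family_on_insert[OF False] by blast
      then show ?thesis
        using cballs_meet_imp_mem_ball[OF n _ \<open>2 * \<delta> < \<epsilon>\<close>] by blast
    qed
  qed
  with T(1) P_bound[OF T(1)] show thesis
    by (intro that) (auto simp: P_def)
qed

section \<open>The packing pre-measures\<close>

lemma infsum_le_premeasure_at:
  fixes I :: "nat set"
  assumes "\<And>i. i \<in> I \<Longrightarrow> N \<le> m i \<and> c i \<in> E"
    and "disjoint_family_on (\<lambda>i. C (m i) (c i) \<epsilon>) I"
  shows "(\<Sum>\<^sub>\<infinity>i\<in>I. ennreal (exp (- s * supS (m i) (c i) \<epsilon>)))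
    \<le> BSP_premeasure_at act F \<Phi> s \<epsilon> N E"
  unfolding BSP_premeasure_at_def
  by (rule Sup_upper, rule CollectI, intro exI conjI) (use assms in auto)

text \<open>In \<open>ennreal\<close> a sum is the supremum of its finite partial sums, and a finite subfamily of a
  disjoint family is again admissible; so only finite families have to be estimated.\<close>

lemma premeasure_at_le:
  assumes le: "\<And>(J :: nat set) c m. finite J \<Longrightarrow> (\<And>i. i \<in> J \<Longrightarrow> N \<le> m i \<and> c i \<in> E)
      \<Longrightarrow> disjoint_family_on (\<lambda>i. C (m i) (c i) \<epsilon>) J
      \<Longrightarrow> (\<Sum>i\<in>J. ennreal (exp (- s * supS (m i) (c i) \<epsilon>))) \<le> K"
  shows "BSP_premeasure_at act F \<Phi> s \<epsilon> N E \<le> K"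
  unfolding BSP_premeasure_at_def
proof (rule Sup_least, clarify)
  fix I :: "nat set" and c :: "nat \<Rightarrow> 'x" and m :: "nat \<Rightarrow> nat"
  assume I: "\<forall>i\<in>I. N \<le> m i \<and> c i \<in> E" "disjoint_family_on (\<lambda>i. C (m i) (c i) \<epsilon>) I"
  show "(\<Sum>\<^sub>\<infinity>i\<in>I. ennreal (exp (- s * supS (m i) (c i) \<epsilon>))) \<le> K"
  proof (rule infsum_le_finite_sums)
    show "(\<lambda>i. ennreal (exp (- s * supS (m i) (c i) \<epsilon>))) summable_on I"
      by (rule nonneg_summable_on_complete) simp
    fix J assume "finite J" "J \<subseteq> I"
    with I show "(\<Sum>i\<in>J. ennreal (exp (- s * supS (m i) (c i) \<epsilon>))) \<le> K"
      by (intro le) (auto intro: disjoint_family_on_mono)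
  qed
qed

lemma premeasure_eq_INF:
  "BSP_premeasure act F \<Phi> s \<epsilon> E = (INF N. BSP_premeasure_at act F \<Phi> s \<epsilon> N E)"
  unfolding BSP_premeasure_def
proof (rule limI, rule LIMSEQ_INF, rule decseq_SucI, rule premeasure_at_le)
  fix N and J :: "nat set" and c m
  assume J: "finite J" "\<And>i. i \<in> J \<Longrightarrow> Suc N \<le> m i \<and> c i \<in> E"
    and disj: "disjoint_family_on (\<lambda>i. C (m i) (c i) \<epsilon>) J"
  have "(\<Sum>\<^sub>\<infinity>i\<in>J. ennreal (exp (- s * supS (m i) (c i) \<epsilon>)))
      \<le> BSP_premeasure_at act F \<Phi> s \<epsilon> N E"
    using J(2) disj by (intro infsum_le_premeasure_at) (auto dest: Suc_leD)
  then show "(\<Sum>i\<in>J. ennreal (exp (- s * supS (m i) (c i) \<epsilon>)))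
      \<le> BSP_premeasure_at act F \<Phi> s \<epsilon> N E"
    using J(1) by (simp del: sum_ennreal)
qed

lemma sum_le_premeasure_at:
  assumes "finite T" "T \<subseteq> E" "N \<le> n" "disjoint_family_on (\<lambda>x. C n x \<epsilon>) T"
  shows "(\<Sum>x\<in>T. ennreal (exp (- s * supS n x \<epsilon>))) \<le> BSP_premeasure_at act F \<Phi> s \<epsilon> N E"
proof -
  obtain c where c: "bij_betw c {..<card T} T"
    using ex_bij_betw_nat_finite[OF \<open>finite T\<close>] by (auto simp: atLeast0LessThan)
  have "(\<Sum>x\<in>T. ennreal (exp (- s * supS n x \<epsilon>)))
      = (\<Sum>i<card T. ennreal (exp (- s * supS n (c i) \<epsilon>)))"
    by (rule sum.reindex_bij_betw[OF c, symmetric])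
  also have "\<dots> = (\<Sum>\<^sub>\<infinity>i\<in>{..<card T}. ennreal (exp (- s * supS n (c i) \<epsilon>)))"
    by (simp del: sum_ennreal)
  also have "\<dots> \<le> BSP_premeasure_at act F \<Phi> s \<epsilon> N E"
  proof (rule infsum_le_premeasure_at)
    show "N \<le> n \<and> c i \<in> E" if "i \<in> {..<card T}" for i
      using assms c that by (auto simp: bij_betw_def)
    show "disjoint_family_on (\<lambda>i. C n (c i) \<epsilon>) {..<card T}"
      using assms(4) c unfolding disjoint_family_on_def bij_betw_def inj_on_def by blast
  qed
  finally show ?thesis .
qed

text \<open>Shrinking the radius keeps balls disjoint and lowers the supremum of the orbit sums, hence raises
  every weight.\<close>

lemma premeasure_antimono:
  assumes "0 < \<delta>" "\<delta> \<le> \<epsilon>" "0 < s"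
  shows "BSP_premeasure act F \<Phi> s \<epsilon> E \<le> BSP_premeasure act F \<Phi> s \<delta> E"
  unfolding premeasure_eq_INF
proof (rule INF_greatest)
  fix N
  \<comment> \<open>The index is raised to at least 1 since nothing is known about balls of time 0.\<close>
  have "BSP_premeasure_at act F \<Phi> s \<epsilon> (max N 1) E \<le> BSP_premeasure_at act F \<Phi> s \<delta> N E"
  proof (rule premeasure_at_le)
    fix J :: "nat set" and c m
    assume J: "finite J" "\<And>i. i \<in> J \<Longrightarrow> max N 1 \<le> m i \<and> c i \<in> E"
      and disj: "disjoint_family_on (\<lambda>i. C (m i) (c i) \<epsilon>) J"
    have "(\<Sum>i\<in>J. ennreal (exp (- s * supS (m i) (c i) \<epsilon>)))
        \<le> (\<Sum>i\<in>J. ennreal (exp (- s * supS (m i) (c i) \<delta>)))"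
      using J assms by (intro sum_mono ennreal_leI) (auto intro!: sup_orbit_sum_mono)
    also have "\<dots> = (\<Sum>\<^sub>\<infinity>i\<in>J. ennreal (exp (- s * supS (m i) (c i) \<delta>)))"
      using J(1) by (simp del: sum_ennreal)
    also have "\<dots> \<le> BSP_premeasure_at act F \<Phi> s \<delta> N E"
    proof (rule infsum_le_premeasure_at)
      show "N \<le> m i \<and> c i \<in> E" if "i \<in> J" for i
        using J(2)[OF that] by simp
      show "disjoint_family_on (\<lambda>i. C (m i) (c i) \<delta>) J"
        using disj cball_mono[OF \<open>\<delta> \<le> \<epsilon>\<close>] unfolding disjoint_family_on_def by blast
    qed
    finally show "(\<Sum>i\<in>J. ennreal (exp (- s * supS (m i) (c i) \<epsilon>)))
        \<le> BSP_premeasure_at act F \<Phi> s \<delta> N E" .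
  qed
  then show "(INF N. BSP_premeasure_at act F \<Phi> s \<epsilon> N E) \<le> BSP_premeasure_at act F \<Phi> s \<delta> N E"
    by (meson INF_lower2 UNIV_I)
qed

lemma BSP_dim_eq_SUP: "BSP_dim act F \<Phi> H = (SUP \<epsilon>\<in>{0<..}. BSP_dim_at act F \<Phi> \<epsilon> H)"
  unfolding BSP_dim_def
proof (rule Lim_at_right_0_antimono)
  fix \<delta> \<epsilon> :: real assume \<delta>: "0 < \<delta>" "\<delta> \<le> \<epsilon>"
  have mono: "BSP_measure act F \<Phi> s \<epsilon> H \<le> BSP_measure act F \<Phi> s \<delta> H" if "0 < s" for s
    unfolding BSP_measure_def
  proof (rule Inf_mono, clarify)
    fix A :: "nat \<Rightarrow> 'x set" assume A: "H \<subseteq> (\<Union>i. A i)"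
    have "(\<Sum>i. BSP_premeasure act F \<Phi> s \<epsilon> (A i)) \<le> (\<Sum>i. BSP_premeasure act F \<Phi> s \<delta> (A i))"
      by (rule suminf_le) (use premeasure_antimono[OF \<delta> that] in auto)
    with A show "\<exists>a\<in>{\<Sum>i. BSP_premeasure act F \<Phi> s \<epsilon> (A i) |A. H \<subseteq> (\<Union>i. A i)}.
        a \<le> (\<Sum>i. BSP_premeasure act F \<Phi> s \<delta> (A i))"
      by blast
  qed
  show "BSP_dim_at act F \<Phi> \<epsilon> H \<le> BSP_dim_at act F \<Phi> \<delta> H"
    unfolding BSP_dim_at_def
  proof (rule Sup_subset_mono, clarify)
    fix s :: real assume "0 < s" "BSP_measure act F \<Phi> s \<epsilon> H = \<infinity>"
    then have "BSP_measure act F \<Phi> s \<delta> H = \<infinity>"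
      using mono[of s] by (simp add: top_unique)
    with \<open>0 < s\<close> show "\<exists>t. ennreal s = ennreal t \<and> 0 < t \<and> BSP_measure act F \<Phi> t \<delta> H = \<infinity>"
      by blast
  qed
qed

end

section \<open>Comparison with a measure\<close>

text \<open>The growth condition on \<open>card (F n)\<close> is used in the form of summability. It serves twice: the
  terms tend to 0 for the upper bound, and their series converges for the lower one.\<close>

locale measured_bowen_system = bowen_system act F \<Phi> + prob_space \<mu>
  for act :: "'g \<Rightarrow> 'x::metric_space \<Rightarrow> 'x"
    and F :: "nat \<Rightarrow> 'g set"
    and \<Phi> :: "'x \<Rightarrow> real"
    and \<mu> :: "'x measure" +
  assumes sets_\<mu>: "sets \<mu> = sets borel"
    and summable_F: "\<And>c. 0 < c \<Longrightarrow> summable (\<lambda>n. exp (- c * real (card (F n))))"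
begin

lemma ball_sets: "1 \<le> n \<Longrightarrow> B n x \<epsilon> \<in> sets \<mu>"
  using open_ball sets_\<mu> by auto

definition entropy_at_scale :: "real \<Rightarrow> 'x \<Rightarrow> ennreal" where
  "entropy_at_scale \<epsilon> x = limsup (\<lambda>n. neg_log (measure \<mu> (B n x \<epsilon>)) / ennreal (S n x))"

lemma upper_BK_eq_SUP: "upper_BK_local_entropy act \<mu> F \<Phi> x = (SUP \<epsilon>\<in>{0<..}. entropy_at_scale \<epsilon> x)"
  unfolding upper_BK_local_entropy_def entropy_at_scale_def
proof (rule Lim_at_right_0_antimono, rule Limsup_mono)
  fix \<delta> \<epsilon> :: real assume "0 < \<delta>" "\<delta> \<le> \<epsilon>"
  then show "\<forall>\<^sub>F n in sequentially. neg_log (measure \<mu> (B n x \<epsilon>)) / ennreal (S n x)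
      \<le> neg_log (measure \<mu> (B n x \<delta>)) / ennreal (S n x)"
    by (intro eventually_sequentiallyI[of 1] divide_right_mono_ennreal neg_log_antimono
        finite_measure_mono ball_mono ball_sets) auto
qed

lemma local_rate_le_iff:
  assumes "1 \<le> n" "0 \<le> t"
  shows "neg_log (measure \<mu> (B n x \<epsilon>)) / ennreal (S n x) \<le> ennreal t
    \<longleftrightarrow> exp (- t * S n x) \<le> measure \<mu> (B n x \<epsilon>)"
  using assms orbit_sum_pos by (intro neg_log_divide_le_iff) auto

lemma sum_measure_disjoint_le_1:
  assumes "finite J" "\<And>i. i \<in> J \<Longrightarrow> 1 \<le> m i"
    and "disjoint_family_on (\<lambda>i. C (m i) (c i) \<epsilon>) J"
  shows "(\<Sum>i\<in>J. measure \<mu> (B (m i) (c i) \<epsilon>)) \<le> 1"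
proof -
  have "disjoint_family_on (\<lambda>i. B (m i) (c i) \<epsilon>) J"
    using assms(3) ball_subset_cball unfolding disjoint_family_on_def by blast
  then have "(\<Sum>i\<in>J. measure \<mu> (B (m i) (c i) \<epsilon>)) = measure \<mu> (\<Union>i\<in>J. B (m i) (c i) \<epsilon>)"
    using assms ball_sets by (intro finite_measure_finite_Union[symmetric]) auto
  then show ?thesis by simp
qed

subsection \<open>Upper bound for the dimension\<close>

text \<open>For a centre \<open>x\<close> in \<open>E\<close> the weight with exponent \<open>r\<close> is at most
  \<open>exp (- (r - t) * S n x) * exp (- t * S n x)\<close>. The second factor is at most the measure of the
  ball, and these measures add up to at most 1 over a disjoint family; the first is uniformly small
  for large times because \<open>S n x \<ge> a * card (F n)\<close>, where \<open>a > 0\<close> is a lower bound for \<open>\<Phi>\<close>.\<close>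

lemma premeasure_eq_0:
  assumes "0 < \<epsilon>" "0 < t" "t < r"
    and low: "\<And>x n. x \<in> E \<Longrightarrow> k \<le> n \<Longrightarrow> exp (- t * S n x) \<le> measure \<mu> (B n x \<epsilon>)"
  shows "BSP_premeasure act F \<Phi> r \<epsilon> E = 0"
proof -
  obtain a b where a: "0 < a" "\<And>x. a \<le> \<Phi> x"
    using \<Phi>_bounds by metis
  have "BSP_premeasure act F \<Phi> r \<epsilon> E \<le> 0 + ennreal \<tau>" if "0 < \<tau>" for \<tau>
  proof -
    have "(\<lambda>n. exp (- ((r - t) * a) * real (card (F n)))) \<longlonglongrightarrow> 0"
      using a \<open>t < r\<close> by (intro summable_LIMSEQ_zero summable_F) auto
    then have "\<forall>\<^sub>F n in sequentially. exp (- ((r - t) * a) * real (card (F n))) < \<tau>"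
      using \<open>0 < \<tau>\<close> by (rule order_tendstoD)
    then obtain N\<^sub>0 where N\<^sub>0: "\<And>n. N\<^sub>0 \<le> n \<Longrightarrow> exp (- ((r - t) * a) * real (card (F n))) < \<tau>"
      by (auto simp: eventually_sequentially)
    define N where "N = max (max N\<^sub>0 k) 1"
    have "BSP_premeasure_at act F \<Phi> r \<epsilon> N E \<le> ennreal \<tau>"
    proof (rule premeasure_at_le)
      fix J :: "nat set" and c m
      assume J: "finite J" "\<And>i. i \<in> J \<Longrightarrow> N \<le> m i \<and> c i \<in> E"
        and disj: "disjoint_family_on (\<lambda>i. C (m i) (c i) \<epsilon>) J"
      have term_le: "exp (- r * supS (m i) (c i) \<epsilon>) \<le> \<tau> * measure \<mu> (B (m i) (c i) \<epsilon>)"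
        if i: "i \<in> J" for i
      proof -
        have m: "N\<^sub>0 \<le> m i" "k \<le> m i" "1 \<le> m i" "c i \<in> E"
          using J(2)[OF i] by (auto simp: N_def)
        have "r * S (m i) (c i) \<le> r * supS (m i) (c i) \<epsilon>"
          using assms m by (intro mult_left_mono orbit_sum_le_sup) auto
        moreover have "(r - t) * (a * real (card (F (m i)))) \<le> (r - t) * S (m i) (c i)"
          using assms a by (intro mult_left_mono orbit_sum_ge) auto
        ultimately have "- r * supS (m i) (c i) \<epsilon>
            \<le> - ((r - t) * a) * real (card (F (m i))) + - t * S (m i) (c i)"
          by (simp add: algebra_simps)
        then have "exp (- r * supS (m i) (c i) \<epsilon>)
            \<le> exp (- ((r - t) * a) * real (card (F (m i)))) * exp (- t * S (m i) (c i))"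
          by (simp only: exp_add[symmetric] exp_le_cancel_iff)
        also have "\<dots> \<le> \<tau> * measure \<mu> (B (m i) (c i) \<epsilon>)"
          using N\<^sub>0[OF m(1)] low[OF m(4,2)] \<open>0 < \<tau>\<close> by (intro mult_mono) auto
        finally show ?thesis .
      qed
      have "(\<Sum>i\<in>J. exp (- r * supS (m i) (c i) \<epsilon>))
          \<le> (\<Sum>i\<in>J. \<tau> * measure \<mu> (B (m i) (c i) \<epsilon>))"
        by (rule sum_mono) (rule term_le)
      also have "\<dots> \<le> \<tau> * 1"
        unfolding sum_distrib_left[symmetric] using \<open>0 < \<tau>\<close> J disj
        by (intro mult_left_mono sum_measure_disjoint_le_1) (auto simp: N_def)
      finally show "(\<Sum>i\<in>J. ennreal (exp (- r * supS (m i) (c i) \<epsilon>))) \<le> ennreal \<tau>"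
        by (simp add: sum_ennreal ennreal_leI)
    qed
    then show ?thesis
      unfolding premeasure_eq_INF by (simp add: INF_lower2)
  qed
  then show ?thesis
    using ennreal_le_epsilon[of 0 "BSP_premeasure act F \<Phi> r \<epsilon> E"] by simp
qed

lemma BSP_dim_le:
  assumes "0 < s" and le: "\<And>x. x \<in> H \<Longrightarrow> upper_BK_local_entropy act \<mu> F \<Phi> x \<le> ennreal s"
  shows "BSP_dim act F \<Phi> H \<le> ennreal s"
  unfolding BSP_dim_eq_SUP BSP_dim_at_def
proof (intro SUP_least Sup_least, clarify)
  fix \<epsilon> r :: real
  assume "0 < \<epsilon>" "0 < r" and inf: "BSP_measure act F \<Phi> r \<epsilon> H = \<infinity>"
  show "ennreal r \<le> ennreal s"
  proof (rule ccontr)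
    assume "\<not> ennreal r \<le> ennreal s"
    then have "s < r"
      using \<open>0 < s\<close> \<open>0 < r\<close> by (simp add: ennreal_le_iff)
    then obtain t where t: "s < t" "t < r"
      using dense by blast
    define E where "E k = {x. \<forall>n\<ge>k. exp (- t * S n x) \<le> measure \<mu> (B n x \<epsilon>)}" for k
    have "H \<subseteq> (\<Union>k. E k)"
    proof
      fix x assume "x \<in> H"
      have "entropy_at_scale \<epsilon> x \<le> ennreal s"
        using le[OF \<open>x \<in> H\<close>] \<open>0 < \<epsilon>\<close> unfolding upper_BK_eq_SUP SUP_le_iff by simp
      then have "entropy_at_scale \<epsilon> x < ennreal t"
        using t \<open>0 < s\<close> by (meson ennreal_lessI le_less_trans less_trans)
      then have "\<forall>\<^sub>F n in sequentially. neg_log (measure \<mu> (B n x \<epsilon>)) / ennreal (S n x) < ennreal t"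
        unfolding entropy_at_scale_def by (rule Limsup_lessD)
      then have "\<forall>\<^sub>F n in sequentially. exp (- t * S n x) \<le> measure \<mu> (B n x \<epsilon>)"
        using eventually_ge_at_top[of 1]
      proof eventually_elim
        case (elim n)
        then show ?case
          using local_rate_le_iff[of n t x \<epsilon>] t \<open>0 < s\<close> by (simp add: less_imp_le)
      qed
      then show "x \<in> (\<Union>k. E k)"
        by (auto simp: E_def eventually_sequentially)
    qed
    moreover have "BSP_premeasure act F \<Phi> r \<epsilon> (E k) = 0" for k
      by (rule premeasure_eq_0[of \<epsilon> t r _ k]) (use t \<open>0 < s\<close> \<open>0 < \<epsilon>\<close> in \<open>auto simp: E_def\<close>)
    ultimately have "BSP_measure act F \<Phi> r \<epsilon> H \<le> (\<Sum>k. 0)"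
      unfolding BSP_measure_def by (intro Inf_lower CollectI exI[of _ E]) simp
    with inf show False by simp
  qed
qed

subsection \<open>Lower bound for the dimension\<close>

text \<open>For each large \<open>n\<close> the points of \<open>E\<close> whose \<open>\<epsilon>\<close>-ball has measure less than \<open>exp (- t * S n x)\<close>
  are covered by a finite union of such balls, centred so that the \<open>\<delta>\<close>-balls are disjoint. Passing
  from the exponent \<open>t\<close> to \<open>r * (1 + \<kappa>) < t\<close> gains the factor \<open>exp (- c * card (F n))\<close>, while the
  remaining sum is a packing sum, bounded by a constant \<open>M\<close>. So the covers have summable measures,
  and almost every point lies in only finitely many of them. Since \<open>E\<close> need not be measurable, the
  conclusion is stated in the completion.\<close>

lemma null_if_premeasure_finite:
  assumes "0 < \<delta>" "2 * \<delta> < \<epsilon>" "0 < r" "r * (1 + \<kappa>) < t"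
    and dist: "\<And>n x. 1 \<le> n \<Longrightarrow> supS n x \<delta> \<le> (1 + \<kappa>) * S n x"
    and fin: "BSP_premeasure act F \<Phi> r \<delta> E < \<infinity>"
  shows "{x \<in> E. \<exists>\<^sub>F n in sequentially. measure \<mu> (B n x \<epsilon>) < exp (- t * S n x)}
    \<in> null_sets (completion \<mu>)"
proof -
  obtain a b where a: "0 < a" "\<And>x. a \<le> \<Phi> x"
    using \<Phi>_bounds by metis
  define c where "c = (t - r * (1 + \<kappa>)) * a"
  have "0 < c" using a assms by (simp add: c_def)
  obtain N where "BSP_premeasure_at act F \<Phi> r \<delta> N E < \<infinity>"
    using fin unfolding premeasure_eq_INF by (auto simp: INF_less_iff)
  then obtain M where M: "BSP_premeasure_at act F \<Phi> r \<delta> N E = ennreal M" "0 \<le> M"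
    by (cases "BSP_premeasure_at act F \<Phi> r \<delta> N E") auto
  define A where "A n = {x\<in>E. measure \<mu> (B n x \<epsilon>) < exp (- t * S n x)}" for n
  have "\<exists>U\<in>sets \<mu>. A n \<subseteq> U \<and> measure \<mu> U \<le> M * exp (- c * real (card (F n)))"
    if n: "max N 1 \<le> n" for n
  proof -
    have n1: "1 \<le> n" "N \<le> n" using n by auto
    obtain T where T: "finite T" "T \<subseteq> A n" "disjoint_family_on (\<lambda>x. C n x \<delta>) T"
      "A n \<subseteq> (\<Union>x\<in>T. B n x \<epsilon>)"
      using finite_disjoint_cballs_covering[OF n1(1) \<open>0 < \<delta>\<close> \<open>2 * \<delta> < \<epsilon>\<close>] .
    have term_le: "measure \<mu> (B n x \<epsilon>) \<le> exp (- c * real (card (F n))) * exp (- r * supS n x \<delta>)"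
      if "x \<in> T" for x
    proof -
      have "r * supS n x \<delta> \<le> r * ((1 + \<kappa>) * S n x)"
        using dist n1 \<open>0 < r\<close> by (intro mult_left_mono) auto
      moreover have "(t - r * (1 + \<kappa>)) * (a * real (card (F n))) \<le> (t - r * (1 + \<kappa>)) * S n x"
        using assms a by (intro mult_left_mono orbit_sum_ge) auto
      ultimately have "- t * S n x \<le> - c * real (card (F n)) + - r * supS n x \<delta>"
        by (simp add: c_def algebra_simps)
      then have "exp (- t * S n x) \<le> exp (- c * real (card (F n))) * exp (- r * supS n x \<delta>)"
        by (simp only: exp_add[symmetric] exp_le_cancel_iff)
      moreover have "measure \<mu> (B n x \<epsilon>) < exp (- t * S n x)"
        using that T(2) by (auto simp: A_def)
      ultimately show ?thesis
        by (rule less_le_trans[THEN less_imp_le, rotated])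
    qed
    have "T \<subseteq> E" using T(2) by (auto simp: A_def)
    then have "(\<Sum>x\<in>T. ennreal (exp (- r * supS n x \<delta>))) \<le> ennreal M"
      unfolding M(1)[symmetric] using T n1 by (intro sum_le_premeasure_at) auto
    then have sum_le: "(\<Sum>x\<in>T. exp (- r * supS n x \<delta>)) \<le> M"
      using M(2) by (simp add: sum_ennreal ennreal_le_iff)
    have "measure \<mu> (\<Union>x\<in>T. B n x \<epsilon>) \<le> (\<Sum>x\<in>T. measure \<mu> (B n x \<epsilon>))"
      using T(1) n1 ball_sets by (intro finite_measure_subadditive_finite) auto
    also have "\<dots> \<le> (\<Sum>x\<in>T. exp (- c * real (card (F n))) * exp (- r * supS n x \<delta>))"
      by (rule sum_mono) (rule term_le)
    also have "\<dots> \<le> M * exp (- c * real (card (F n)))"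
      unfolding sum_distrib_left[symmetric] using sum_le by simp
    finally show ?thesis
      using T ball_sets[OF n1(1)] by (intro bexI[of _ "\<Union>x\<in>T. B n x \<epsilon>"]) auto
  qed
  then obtain U where U: "\<And>n. max N 1 \<le> n \<Longrightarrow> U n \<in> sets \<mu>"
    "\<And>n. max N 1 \<le> n \<Longrightarrow> A n \<subseteq> U n"
    "\<And>n. max N 1 \<le> n \<Longrightarrow> measure \<mu> (U n) \<le> M * exp (- c * real (card (F n)))"
    by metis
  \<comment> \<open>Finitely many times do not affect the upper limit, so early covers are replaced by the empty set.\<close>
  define V where "V n = (if max N 1 \<le> n then U n else {})" for n
  have "limsup V \<in> null_sets \<mu>"
  proof (rule borel_cantelli_limsup1)
    show "V n \<in> sets \<mu>" for n using U(1) by (simp add: V_def)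
    show "emeasure \<mu> (V n) < \<infinity>" for n by (simp add: less_top[symmetric])
    show "summable (\<lambda>n. measure \<mu> (V n))"
    proof (rule summable_comparison_test')
      show "summable (\<lambda>n. M * exp (- c * real (card (F n))))"
        using summable_F[OF \<open>0 < c\<close>] by (rule summable_mult)
      show "norm (measure \<mu> (V n)) \<le> M * exp (- c * real (card (F n)))" if "0 \<le> n" for n
        using U(3) M(2) by (simp add: V_def)
    qed
  qed
  moreover have "{x \<in> E. \<exists>\<^sub>F n in sequentially. measure \<mu> (B n x \<epsilon>) < exp (- t * S n x)} \<subseteq> limsup V"
  proof clarify
    fix x assume x: "x \<in> E" and freq: "\<exists>\<^sub>F n in sequentially. measure \<mu> (B n x \<epsilon>) < exp (- t * S n x)"
    have "\<exists>n\<ge>k. x \<in> V n" for k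
    proof -
      obtain n where "max k (max N 1) \<le> n" "measure \<mu> (B n x \<epsilon>) < exp (- t * S n x)"
        using freq unfolding frequently_sequentially by blast
      then show ?thesis
        using U(2)[of n] x by (auto simp: V_def A_def intro!: exI[of _ n])
    qed
    then show "x \<in> limsup V"
      by (auto simp: limsup_INF_SUP)
  qed
  ultimately show ?thesis
    unfolding null_sets_completion_iff2 by blast
qed

lemma null_if_measure_finite:
  assumes "0 < \<delta>" "2 * \<delta> < \<epsilon>" "0 < r" "r * (1 + \<kappa>) < t"
    and dist: "\<And>n x. 1 \<le> n \<Longrightarrow> supS n x \<delta> \<le> (1 + \<kappa>) * S n x"
    and fin: "BSP_measure act F \<Phi> r \<delta> H < \<infinity>"
  shows "{x \<in> H. \<exists>\<^sub>F n in sequentially. measure \<mu> (B n x \<epsilon>) < exp (- t * S n x)}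
    \<in> null_sets (completion \<mu>)"
proof -
  obtain A where A: "H \<subseteq> (\<Union>i. A i)" "(\<Sum>i. BSP_premeasure act F \<Phi> r \<delta> (A i)) < \<infinity>"
    using fin unfolding BSP_measure_def by (auto simp: Inf_less_iff)
  have "BSP_premeasure act F \<Phi> r \<delta> (A i) < \<infinity>" for i
    using ennreal_suminf_lessD[OF A(2)] .
  then have "(\<Union>i. {x \<in> A i. \<exists>\<^sub>F n in sequentially. measure \<mu> (B n x \<epsilon>) < exp (- t * S n x)})
      \<in> null_sets (completion \<mu>)"
    by (intro null_sets_UN null_if_premeasure_finite[OF assms(1-4) dist])
  then show ?thesis
    by (rule null_sets_completion_subset[rotated]) (use A(1) in blast)
qed

text \<open>If the dimension were below \<open>r < s\<close>, the packing measure with exponent \<open>r\<close> would be finite at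
  every scale, hence the points of \<open>H\<close> with infinitely many small \<open>\<epsilon>\<close>-balls would be null for every
  \<open>\<epsilon>\<close>. Since smaller balls have smaller measure, the scales \<open>1 / Suc k\<close> exhaust \<open>H\<close>, so \<open>H\<close> would
  be null.\<close>

lemma BSP_dim_ge:
  assumes ge: "\<And>x. x \<in> H \<Longrightarrow> ennreal s \<le> upper_BK_local_entropy act \<mu> F \<Phi> x"
    and pos: "0 < emeasure (completion \<mu>) H"
  shows "ennreal s \<le> BSP_dim act F \<Phi> H"
proof (rule ccontr)
  assume "\<not> ennreal s \<le> BSP_dim act F \<Phi> H"
  then obtain q where q: "BSP_dim act F \<Phi> H < q" "q < ennreal s"
    using dense[of "BSP_dim act F \<Phi> H" "ennreal s"] by (auto simp: not_le)
  then obtain r where r: "q = ennreal r" "0 \<le> r"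
    by (cases q) auto
  have "r \<noteq> 0"
    using q(1) r(1) by auto
  with q r have "0 < r" "r < s"
    by (auto simp: ennreal_less_iff)
  define t where "t = (r + s) / 2"
  have t: "r < t" "t < s" "0 < t"
    using \<open>0 < r\<close> \<open>r < s\<close> by (auto simp: t_def)
  \<comment> \<open>This value makes \<open>r * (1 + \<kappa>)\<close> the midpoint of \<open>r\<close> and \<open>t\<close>.\<close>
  define \<kappa> where "\<kappa> = (t - r) / (2 * r)"
  have \<kappa>: "0 < \<kappa>" "r * (1 + \<kappa>) < t"
    using t \<open>0 < r\<close> by (auto simp: \<kappa>_def field_simps)
  obtain \<delta>\<^sub>0 where \<delta>\<^sub>0: "0 < \<delta>\<^sub>0"
    "\<And>\<delta> n x. 0 \<le> \<delta> \<Longrightarrow> \<delta> < \<delta>\<^sub>0 \<Longrightarrow> 1 \<le> n \<Longrightarrow> supS n x \<delta> \<le> (1 + \<kappa>) * S n x"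
    using small_distortion[OF \<kappa>(1)] by blast
  have fin: "BSP_measure act F \<Phi> r \<delta> H < \<infinity>" if "0 < \<delta>" for \<delta>
  proof (rule ccontr)
    assume "\<not> BSP_measure act F \<Phi> r \<delta> H < \<infinity>"
    then have "BSP_measure act F \<Phi> r \<delta> H = \<infinity>"
      by (simp add: less_top[symmetric])
    then have "ennreal r \<le> BSP_dim_at act F \<Phi> \<delta> H"
      unfolding BSP_dim_at_def using \<open>0 < r\<close> by (intro Sup_upper) auto
    also have "\<dots> \<le> BSP_dim act F \<Phi> H"
      unfolding BSP_dim_eq_SUP using that by (intro SUP_upper) auto
    finally show False using q r by simp
  qed
  define D where "D \<epsilon> = {x\<in>H. \<exists>\<^sub>F n in sequentially. measure \<mu> (B n x \<epsilon>) < exp (- t * S n x)}" for \<epsilon>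
  have D_null: "D \<epsilon> \<in> null_sets (completion \<mu>)" if "0 < \<epsilon>" for \<epsilon>
  proof -
    define \<delta> where "\<delta> = min \<delta>\<^sub>0 \<epsilon> / 3"
    have "0 < \<delta>" "\<delta> < \<delta>\<^sub>0" "2 * \<delta> < \<epsilon>"
      using \<open>0 < \<delta>\<^sub>0\<close> that by (auto simp: \<delta>_def min_def)
    then show ?thesis
      unfolding D_def using fin \<delta>\<^sub>0(2) \<kappa> \<open>0 < r\<close>
      by (intro null_if_measure_finite[of \<delta> \<epsilon> r \<kappa>]) auto
  qed
  have "H \<subseteq> (\<Union>k. D (1 / Suc k))"
  proof
    fix x assume "x \<in> H"
    have "ennreal t < ennreal s"
      using t by (simp add: ennreal_less_iff)
    then have "ennreal t < (SUP \<epsilon>\<in>{0<..}. entropy_at_scale \<epsilon> x)"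
      using ge[OF \<open>x \<in> H\<close>] unfolding upper_BK_eq_SUP by simp
    then obtain \<epsilon> where \<epsilon>: "0 < \<epsilon>" "ennreal t < entropy_at_scale \<epsilon> x"
      by (auto simp: less_SUP_iff)
    have freq: "\<exists>\<^sub>F n in sequentially. measure \<mu> (B n x \<epsilon>) < exp (- t * S n x)"
    proof (rule ccontr)
      assume "\<not> ?thesis"
      then have "\<forall>\<^sub>F n in sequentially. exp (- t * S n x) \<le> measure \<mu> (B n x \<epsilon>)"
        by (simp add: not_frequently not_less)
      then have "\<forall>\<^sub>F n in sequentially. neg_log (measure \<mu> (B n x \<epsilon>)) / ennreal (S n x) \<le> ennreal t"
        using eventually_ge_at_top[of 1]
      proof eventually_elim
        case (elim n)
        then show ?case
          using local_rate_le_iff[of n t x \<epsilon>] t by simp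
      qed
      then have "entropy_at_scale \<epsilon> x \<le> ennreal t"
        unfolding entropy_at_scale_def by (rule Limsup_bounded)
      with \<epsilon> show False by simp
    qed
    obtain k where k: "1 / Suc k < \<epsilon>"
      using nat_approx_posE[OF \<epsilon>(1)] by (metis of_nat_Suc)
    have "\<exists>\<^sub>F n in sequentially. 1 \<le> n \<and> measure \<mu> (B n x \<epsilon>) < exp (- t * S n x)"
      using frequently_eventually_conj[OF freq eventually_ge_at_top[of 1]] .
    then have "\<exists>\<^sub>F n in sequentially. measure \<mu> (B n x (1 / Suc k)) < exp (- t * S n x)"
    proof (rule frequently_elim1)
      fix n assume n: "1 \<le> n \<and> measure \<mu> (B n x \<epsilon>) < exp (- t * S n x)"
      have "measure \<mu> (B n x (1 / Suc k)) \<le> measure \<mu> (B n x \<epsilon>)"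
        using n k ball_sets by (intro finite_measure_mono ball_mono) auto
      with n show "measure \<mu> (B n x (1 / Suc k)) < exp (- t * S n x)" by simp
    qed
    then show "x \<in> (\<Union>k. D (1 / Suc k))"
      using \<open>x \<in> H\<close> by (auto simp: D_def)
  qed
  moreover have "(\<Union>k. D (1 / Suc k)) \<in> null_sets (completion \<mu>)"
    by (intro null_sets_UN D_null) simp
  ultimately have "H \<in> null_sets (completion \<mu>)"
    by (rule null_sets_completion_subset)
  with pos show False by auto
qed

end

section \<open>Amenable group actions\<close>

theorem theorem4p9:
  fixes G :: "('g, 'b) monoid_scheme"
    and act :: "'g \<Rightarrow> 'x::metric_space \<Rightarrow> 'x"
    and F :: "nat \<Rightarrow> 'g set"
    and \<mu> :: "'x measure"
    and H :: "'x set"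
    and \<Phi> :: "'x \<Rightarrow> real"
    and s :: real
  assumes "group G" and "countable (carrier G)" and "infinite (carrier G)" and "amenable G"
    and "compact (UNIV :: 'x set)"
    and "continuous_action G act"
    and "folner_sequence G F"
    and "mono_on {1..} (\<lambda>n. card (F n))"
    and "filterlim (\<lambda>n. real (card (F n)) / ln (real n)) at_top sequentially"
    and "\<mu> \<in> borel_prob_measures"
    and "continuous_on UNIV \<Phi>" and "\<And>x. \<Phi> x > 0"
    and "s > 0"
  shows "((\<forall>x\<in>H. upper_BK_local_entropy act \<mu> F \<Phi> x \<le> ennreal s)
            \<longrightarrow> BSP_dim act F \<Phi> H \<le> ennreal s)
       \<and> ((\<forall>x\<in>H. upper_BK_local_entropy act \<mu> F \<Phi> x \<ge> ennreal s)
            \<and> H \<in> sets (completion \<mu>) \<and> emeasure (completion \<mu>) H > 0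
            \<longrightarrow> BSP_dim act F \<Phi> H \<ge> ennreal s)"
proof -
  have F: "finite (F n)" "F n \<noteq> {}" "F n \<subseteq> carrier G" if "1 \<le> n" for n
    using \<open>folner_sequence G F\<close> that unfolding folner_sequence_def by auto
  have act: "continuous_on UNIV (act g)" if "g \<in> carrier G" for g
    using \<open>continuous_action G act\<close> that unfolding continuous_action_def by blast
  have \<mu>: "prob_space \<mu>" "sets \<mu> = sets borel"
    using \<open>\<mu> \<in> borel_prob_measures\<close> unfolding borel_prob_measures_def by auto
  have "bowen_system act F \<Phi>"
    using assms(5,11,12) F act by unfold_locales blast+
  moreover have "measured_bowen_system_axioms F \<mu>"
    using \<mu>(2) summable_exp_minus_mult[OF assms(9)] by unfold_locales auto
  ultimately interpret measured_bowen_system act F \<Phi> \<mu>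
    using \<mu>(1) by (simp add: measured_bowen_system_def)
  show ?thesis
    using BSP_dim_le[OF \<open>s > 0\<close>] BSP_dim_ge by blast
qed

end
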